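(* For any nonnegative integer $n$, the following hold: \[ \begin{aligned} (a)\quad & H_0(n) =\begin{cases} \frac{\overline{p}_o(n)}{2} +1 & \text{if $n$ is a square,} \\ \frac{\overline{p}_o(n)}{2} & \text{otherwise,} \end{cases}\\ (b)\quad & H_1(n) =\begin{cases} \frac{\overline{p}_o(n)}{2}-1 & \text{if $n$ is a square,} \\ \frac{\overline{p}_o(n)}{2} & \text{otherwise,} \end{cases} \\ (c)\quad & H_2(n) =\begin{cases} \frac{\overline{p}_o(n)}{2} +(-1)^n & \text{if $n$ is a square,} \\ \frac{\overline{p}_o(n)}{2} & \text{otherwise,} \end{cases} \\ (d)\quad & H_3(n) =\begin{cases} \frac{\overline{p}_o(n)}{2}-(-1)^n & \text{if $n$ is a square,} \\ \frac{\overline{p}_o(n)}{2} & \text{otherwise.} \end{cases} \end{aligned} \]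
   Context: A two-color partition of $n$ is a finite multiset of positive integers (parts), each part colored red or blue, whose sum is $n$ (the same integer in two different colors counts as two different kinds of parts). For a nonnegative integer $n$, $\mathcal{F}(n)$ is the set of two-color partitions of $n$ in which even parts may occur only in blue color (odd parts may occur in either color). $\mathcal{H}(n)$ is the subset of $\mathcal{F}(n)$ consisting of those partitions in which parts of the same color do not repeat (so each even integer occurs at most once, in blue, and each odd integer occurs at most once in blue and at most once in red). $H_0(n)$ (resp. $H_1(n)$) is the number of partitions in $\mathcal{H}(n)$ in which the number of even parts is even (resp. odd). $H_2(n)$ (resp. $H_3(n)$) is the number of partitions in $\mathcal{H}(n)$ in which the total number of parts is even (resp. odd). $\overline{p}_o(n)$ is the number of overpartitions of $n$ into odd parts, i.e. partitions of $n$ into odd parts in which the first occurrence of each part size may be overlined.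
   Formalization: The formal statement assumes n ≥ 1 instead of any nonnegative integer n: at n = 0 the identities fail, since H_0(0) = 1 and the number of overpartitions of 0 into odd parts is 1, while (a) would give 3/2. *)

theory Defs
  imports Complex_Main "HOL-Library.Multiset"
begin

datatype color = Red | Blue

(* A part is a pair (size, color); a two-color partition is a multiset of parts. *)
definition two_color_partitions :: "nat \<Rightarrow> (nat \<times> color) multiset set" where
  "two_color_partitions n =
     {P. (\<forall>p \<in># P. 0 < fst p) \<and> (\<Sum>p\<in>#P. fst p) = n}"

definition F_set :: "nat \<Rightarrow> (nat \<times> color) multiset set" where
  "F_set n = {P \<in> two_color_partitions n. \<forall>p \<in># P. even (fst p) \<longrightarrow> snd p = Blue}"

definition H_set :: "nat \<Rightarrow> (nat \<times> color) multiset set" where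
  "H_set n = {P \<in> F_set n. \<forall>p. count P p \<le> 1}"

definition even_parts :: "(nat \<times> color) multiset \<Rightarrow> nat" where
  "even_parts P = size {#p \<in># P. even (fst p)#}"

definition H0 :: "nat \<Rightarrow> nat" where
  "H0 n = card {P \<in> H_set n. even (even_parts P)}"

definition H1 :: "nat \<Rightarrow> nat" where
  "H1 n = card {P \<in> H_set n. odd (even_parts P)}"

definition H2 :: "nat \<Rightarrow> nat" where
  "H2 n = card {P \<in> H_set n. even (size P)}"

definition H3 :: "nat \<Rightarrow> nat" where
  "H3 n = card {P \<in> H_set n. odd (size P)}"

(* Since only the first occurrence of a part size may be overlined, an overpartition is a
   partition M together with the set S of those part sizes whose first occurrence is overlined. *)
definition odd_overpartitions :: "nat \<Rightarrow> (nat multiset \<times> nat set) set" where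
  "odd_overpartitions n = {(M, S). (\<forall>m \<in># M. odd m) \<and> \<Sum>\<^sub># M = n \<and> S \<subseteq> set_mset M}"

definition p_o :: "nat \<Rightarrow> nat" where
  "p_o n = card (odd_overpartitions n)"

(* The cardinalities above are those of finite sets. *)

lemma finite_bounded_multisets:
  assumes "finite A"
  shows "finite {M. set_mset M \<subseteq> A \<and> size M \<le> n}"
proof -
  have "{M. set_mset M \<subseteq> A \<and> size M \<le> n} \<subseteq> mset ` {xs. set xs \<subseteq> A \<and> length xs \<le> n}"
  proof
    fix M assume M: "M \<in> {M. set_mset M \<subseteq> A \<and> size M \<le> n}"
    obtain xs where "mset xs = M" using ex_mset by blast
    with M show "M \<in> mset ` {xs. set xs \<subseteq> A \<and> length xs \<le> n}" by auto
  qed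
  then show ?thesis
    using finite_lists_length_le[OF assms] finite_surj by blast
qed

lemma size_le_sum_mset:
  fixes f :: "'a \<Rightarrow> nat"
  assumes "\<forall>p \<in># P. 0 < f p"
  shows "size P \<le> (\<Sum>p\<in>#P. f p)"
  using assms by (induction P) auto

lemma finite_two_color_partitions: "finite (two_color_partitions n)"
proof -
  have fin: "finite ({..n} \<times> {Red, Blue})" by simp
  have "two_color_partitions n \<subseteq> {P. set_mset P \<subseteq> {..n} \<times> {Red, Blue} \<and> size P \<le> n}"
  proof
    fix P assume P: "P \<in> two_color_partitions n"
    then have "size P \<le> n"
      using size_le_sum_mset[of P fst] by (auto simp: two_color_partitions_def)
    moreover have "p \<in> {..n} \<times> {Red, Blue}" if p: "p \<in># P" for p
    proof -
      obtain Q where "P = add_mset p Q" using multi_member_split[OF p] by blast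
      then have "fst p \<le> n" using P by (auto simp: two_color_partitions_def)
      then show ?thesis by (cases p; cases "snd p") auto
    qed
    ultimately show "P \<in> {P. set_mset P \<subseteq> {..n} \<times> {Red, Blue} \<and> size P \<le> n}" by blast
  qed
  then show ?thesis using finite_bounded_multisets[OF fin] finite_subset by blast
qed

lemma finite_H_set: "finite (H_set n)"
  using finite_two_color_partitions[of n] by (auto simp: H_set_def F_set_def)

lemma finite_odd_overpartitions: "finite (odd_overpartitions n)"
proof -
  let ?B = "{M :: nat multiset. set_mset M \<subseteq> {..n} \<and> size M \<le> n} \<times> Pow {..n}"
  have "x \<in> ?B" if "x \<in> odd_overpartitions n" for x
  proof -
    obtain M S where x: "x = (M, S)" by (cases x)
    with that have M: "\<forall>m \<in># M. odd m" and sum: "\<Sum>\<^sub># M = n" and S: "S \<subseteq> set_mset M"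
      by (auto simp: odd_overpartitions_def)
    have "size M \<le> n"
      using size_le_sum_mset[of M "\<lambda>m. m"] M sum by (auto simp: odd_pos)
    moreover have "set_mset M \<subseteq> {..n}"
    proof
      fix m assume m: "m \<in># M"
      obtain Q where "M = add_mset m Q" using multi_member_split[OF m] by blast
      then have "\<Sum>\<^sub># M = m + \<Sum>\<^sub># Q" by simp
      then show "m \<in> {..n}" using sum by simp
    qed
    ultimately show ?thesis using x S by auto
  qed
  then have "odd_overpartitions n \<subseteq> ?B" by blast
  moreover have "finite ?B"
    by (intro finite_cartesian_product finite_bounded_multisets) auto
  ultimately show ?thesis by (rule finite_subset)
qed

end

theory Submission
  imports Defs "HOL-Computational_Algebra.Formal_Power_Series"
begin

text \<open>
  The members of \<^term>\<open>H_set n\<close> amount to sets of admissible parts, so they are counted by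
  the product \<open>\<Prod>(1 + q\<^sup>2\<^sup>i)(1 + q\<^sup>2\<^sup>i\<^sup>-\<^sup>1)\<^sup>2\<close> over \<open>i \<ge> 1\<close>, one factor for each admissible coloured part.
  The theorem amounts to evaluating \<open>H0 + H1\<close> and \<open>H0 - H1\<close>.

  For the sum, overpartitions into odd parts have generating function
  \<open>\<Prod>(1 + q\<^sup>2\<^sup>i\<^sup>-\<^sup>1) / (1 - q\<^sup>2\<^sup>i\<^sup>-\<^sup>1)\<close>, and by Euler the factor \<open>\<Prod>1 / (1 - q\<^sup>2\<^sup>i\<^sup>-\<^sup>1)\<close> equals
  \<open>\<Prod>(1 + q\<^sup>i) = \<Prod>(1 + q\<^sup>2\<^sup>i)(1 + q\<^sup>2\<^sup>i\<^sup>-\<^sup>1)\<close>. Hence \<open>H0 n + H1 n = p_o n\<close>; see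
  \<open>euler_product_mod\<close>, \<open>overpartition_gf_eq\<close> and \<open>card_H_set_eq_p_o\<close>.

  For the difference, counting each even part with sign \<open>-1\<close> gives
  \<open>\<Prod>(1 - q\<^sup>2\<^sup>i)(1 + q\<^sup>2\<^sup>i\<^sup>-\<^sup>1)\<^sup>2\<close>, which is the theta series \<open>\<Sum>q^(k\<^sup>2)\<close> over all integers \<open>k\<close>, the
  case \<open>z = 1\<close> of Jacobi's triple product. A positive square arises from \<open>k\<close> and \<open>-k\<close>, so
  \<open>H0 n - H1 n\<close> is \<open>2\<close> or \<open>0\<close>. The theta series is obtained from the finite q-binomial theorem
  \<open>q_binomial_theorem\<close>; see \<open>theta_product_mod\<close> and \<open>theta_product_nth\<close>.

  Finally, the number of odd parts of a partition of \<open>n\<close> has the parity of \<open>n\<close>. So the pair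
  \<open>H2\<close>, \<open>H3\<close> is the pair \<open>H0\<close>, \<open>H1\<close>, exchanged when \<open>n\<close> is odd (\<open>H2_H3_eq\<close>).

  All products are kept finite: with \<open>N\<close> factors of each kind, the identities hold modulo
  \<open>q\<^sup>2\<^sup>N\<^sup>+\<^sup>1\<close>, which determines every coefficient up to \<open>2 * N\<close>.
\<close>

unbundle fps_syntax

section \<open>Gaussian binomial coefficients\<close>

text \<open>
  The q-Pochhammer symbol \<open>(q; q)\<^sub>n\<close>.
\<close>

definition qpoch :: "'a::comm_ring_1 \<Rightarrow> nat \<Rightarrow> 'a" where
  "qpoch q n = (\<Prod>i<n. 1 - q ^ Suc i)"

text \<open>
  The Gaussian binomial coefficient, defined by the q-Pascal rule so that no division is needed
  and \<open>q\<close> may lie in any commutative ring.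
\<close>

fun qbinom :: "'a::comm_ring_1 \<Rightarrow> nat \<Rightarrow> nat \<Rightarrow> 'a" where
  "qbinom q n 0 = 1"
| "qbinom q 0 (Suc k) = 0"
| "qbinom q (Suc n) (Suc k) = qbinom q n k + q ^ Suc k * qbinom q n (Suc k)"

lemma qpoch_0 [simp]: "qpoch q 0 = 1"
  and qpoch_Suc: "qpoch q (Suc n) = qpoch q n * (1 - q ^ Suc n)"
  by (simp_all add: qpoch_def)

lemma qbinom_eq_0: "n < k \<Longrightarrow> qbinom q n k = 0"
  by (induction q n k rule: qbinom.induct) auto

text \<open>
  The quotient formula for the Gaussian binomial, with denominators cleared. In the step the two
  terms of the q-Pascal rule contribute \<open>1 - q\<^sup>j\<^sup>+\<^sup>1\<close> and \<open>q\<^sup>j\<^sup>+\<^sup>1 (1 - q\<^sup>l\<^sup>+\<^sup>1)\<close> times \<open>(q; q)\<^sub>n\<close>, where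
  \<open>n + 1 = (j + 1) + (l + 1)\<close>, and these factors add up to \<open>1 - q\<^sup>n\<^sup>+\<^sup>1\<close>.
\<close>

lemma qbinom_mult_qpoch:
  "k \<le> n \<Longrightarrow> qbinom q n k * (qpoch q k * qpoch q (n - k)) = qpoch q n"
proof (induction n arbitrary: k)
  case (Suc n)
  show ?case
  proof (cases k)
    case k: (Suc j)
    show ?thesis
    proof (cases "j = n")
      case True
      then have "qbinom q n j * qpoch q j = qpoch q n" using Suc.IH[of n] by simp
      then show ?thesis using True k by (simp add: qbinom_eq_0 qpoch_Suc flip: mult.assoc)
    next
      case False
      then obtain l where n: "n = Suc (j + l)"
        using Suc.prems k less_imp_Suc_add[of j n] by auto
      have "qbinom q n j * (qpoch q j * qpoch q (Suc l)) = qpoch q n"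
        and "qbinom q n (Suc j) * (qpoch q (Suc j) * qpoch q l) = qpoch q n"
        using Suc.IH[of j] Suc.IH[of "Suc j"] by (simp_all add: n Suc_diff_le)
      moreover have "qbinom q (Suc n) (Suc j) * (qpoch q (Suc j) * qpoch q (Suc l)) =
          qbinom q n j * (qpoch q j * qpoch q (Suc l)) * (1 - q ^ Suc j) +
          q ^ Suc j * (qbinom q n (Suc j) * (qpoch q (Suc j) * qpoch q l)) * (1 - q ^ Suc l)"
        by (simp add: qpoch_Suc algebra_simps)
      ultimately have "qbinom q (Suc n) (Suc j) * (qpoch q (Suc j) * qpoch q (Suc l)) =
          qpoch q n * (1 - q ^ Suc j) + q ^ Suc j * qpoch q n * (1 - q ^ Suc l)"
        by simp
      also have "\<dots> = qpoch q (Suc n)"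
        by (simp add: qpoch_Suc n algebra_simps power_add)
      finally show ?thesis by (simp add: k n Suc_diff_le)
    qed
  qed simp
qed simp

text \<open>
  Splitting off the factor \<open>i = 0\<close> leaves the same product with \<open>x * q\<close> in place of \<open>x\<close>; comparing
  coefficients of powers of \<open>x\<close> then gives the q-Pascal rule. The homogeneous form in \<open>x\<close> and \<open>y\<close>
  makes it possible to specialise symmetrically without negative powers of \<open>q\<close>.
\<close>

lemma q_binomial_theorem:
  fixes q x y :: "'a::comm_ring_1"
  shows "(\<Prod>i<n. y + x * q ^ i) = (\<Sum>j\<le>n. q ^ (j choose 2) * qbinom q n j * x ^ j * y ^ (n - j))"
proof (induction n arbitrary: x)
  case (Suc n)
  let ?s = "\<lambda>j. q ^ (j choose 2) * qbinom q n j * (x * q) ^ j * y ^ (n - j)"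
  let ?t = "\<lambda>j. q ^ (j choose 2) * (q ^ j * qbinom q n j) * x ^ j * y ^ (Suc n - j)"
  let ?u = "\<lambda>j. q ^ (Suc j choose 2) * qbinom q n j * x ^ Suc j * y ^ (n - j)"
  have choose: "Suc j choose 2 = (j choose 2) + j" for j
    by (simp add: numeral_2_eq_2)
  have "(\<Prod>i<Suc n. y + x * q ^ i) = (y + x) * (\<Prod>i<n. y + (x * q) * q ^ i)"
    by (simp add: prod.lessThan_Suc_shift mult.assoc del: prod.lessThan_Suc)
  also have "\<dots> = y * (\<Sum>j\<le>n. ?s j) + x * (\<Sum>j\<le>n. ?s j)"
    unfolding Suc.IH by (rule distrib_right)
  also have "\<dots> = (\<Sum>j\<le>n. ?t j) + (\<Sum>j\<le>n. ?u j)"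
    unfolding sum_distrib_left
    by (intro arg_cong2[where f="(+)"] sum.cong refl)
       (simp_all add: choose power_mult_distrib power_add Suc_diff_le mult_ac)
  \<comment> \<open>The added term vanishes, since its Gaussian binomial is \<open>0\<close>.\<close>
  also have "(\<Sum>j\<le>n. ?t j) = (\<Sum>j\<le>Suc n. ?t j)"
    by (simp add: qbinom_eq_0)
  also have "\<dots> = ?t 0 + (\<Sum>j\<le>n. ?t (Suc j))"
    by (rule sum.atMost_Suc_shift)
  also have "\<dots> + (\<Sum>j\<le>n. ?u j) = ?t 0 + (\<Sum>j\<le>n. ?t (Suc j) + ?u j)"
    by (simp add: sum.distrib)
  also have "\<dots> = (\<Sum>j\<le>Suc n. q ^ (j choose 2) * qbinom q (Suc n) j * x ^ j * y ^ (Suc n - j))"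
    unfolding sum.atMost_Suc_shift
    by (intro arg_cong2[where f="(+)"] sum.cong refl) (simp_all add: algebra_simps)
  finally show ?case .
qed (simp add: numeral_2_eq_2)

section \<open>The theta product and Euler's product\<close>

lemma mod_fps_X_power_nth:
  fixes f g :: "real fps"
  assumes "f mod fps_X ^ m = g mod fps_X ^ m" "n < m"
  shows "f $ n = g $ n"
proof -
  from assms obtain h where "f - g = fps_X ^ m * h"
    by (auto simp: mod_eq_dvd_iff dvd_def)
  then have "(f - g) $ n = 0" using assms(2) by (simp only: fps_X_power_mult_nth if_True)
  then show ?thesis by simp
qed

lemma qpoch_nth_0:
  fixes q :: "real fps"
  assumes "q $ 0 = 0"
  shows "qpoch q n $ 0 = 1"
  by (induction n) (simp_all add: assms qpoch_Suc fps_power_zeroth)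

lemma qpoch_mod:
  fixes q :: "real fps"
  assumes "r \<le> n"
  shows "qpoch q n mod q ^ Suc r = qpoch q r mod q ^ Suc r"
  using assms
proof (induction n rule: dec_induct)
  case (step n)
  have "q ^ Suc r dvd q ^ Suc n" using step.hyps by (intro le_imp_power_dvd) simp
  moreover have "qpoch q (Suc n) - qpoch q n = q ^ Suc n * - qpoch q n"
    by (simp add: qpoch_Suc algebra_simps)
  ultimately have "q ^ Suc r dvd qpoch q (Suc n) - qpoch q n"
    by (metis dvd_mult2)
  then show ?case using step.IH by (simp add: mod_eq_dvd_iff[symmetric])
qed simp

lemma cancel_unit_mod:
  fixes f g u m :: "real fps"
  assumes "u $ 0 \<noteq> 0" "(u * f) mod m = (u * g) mod m"
  shows "f mod m = g mod m"
proof -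
  have "m dvd u * (f - g)" using assms(2) by (simp add: mod_eq_dvd_iff algebra_simps)
  then show ?thesis using assms(1) by (simp add: mod_eq_dvd_iff dvd_mult_unit_iff')
qed

text \<open>
  A central Gaussian binomial times \<open>(q; q)\<^sub>N\<close> is \<open>1\<close> up to high order. Indeed, for
  \<open>r = min a b\<close> the products \<open>(q; q)\<^sub>n\<close> with \<open>n \<ge> r\<close> all agree modulo \<open>q\<^sup>r\<^sup>+\<^sup>1\<close>, and by the quotient formula the
  left-hand side is \<open>(q; q)\<^sub>a\<^sub>+\<^sub>b (q; q)\<^sub>N / ((q; q)\<^sub>a (q; q)\<^sub>b)\<close>, with as many such products above as
  below. Multiplying by the denominator, a unit, avoids the division.
\<close>

lemma qbinom_mult_qpoch_mod:
  fixes q :: "real fps"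
  assumes "q $ 0 = 0" "min a b \<le> N"
  shows "(qbinom q (a + b) a * qpoch q N) mod q ^ Suc (min a b) = 1 mod q ^ Suc (min a b)"
proof (rule cancel_unit_mod)
  let ?r = "min a b"
  show "(qpoch q a * qpoch q b) $ 0 \<noteq> 0" by (simp add: qpoch_nth_0 assms(1))
  have "qpoch q a * qpoch q b * (qbinom q (a + b) a * qpoch q N) = qpoch q (a + b) * qpoch q N"
    using qbinom_mult_qpoch[of a "a + b" q] by (simp add: mult_ac)
  also have "\<dots> mod q ^ Suc ?r = (qpoch q ?r * qpoch q ?r) mod q ^ Suc ?r"
    using assms(2) by (intro mod_mult_cong qpoch_mod) auto
  also have "\<dots> = (qpoch q a * qpoch q b) mod q ^ Suc ?r"
    by (intro mod_mult_cong qpoch_mod[symmetric]) auto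
  finally show "(qpoch q a * qpoch q b * (qbinom q (a + b) a * qpoch q N)) mod q ^ Suc ?r =
      (qpoch q a * qpoch q b * 1) mod q ^ Suc ?r" by simp
qed

text \<open>
  A finite form of the theta identity. It comes from the q-binomial theorem with \<open>q\<^sup>2\<close> for \<open>q\<close>,
  \<open>2 * N\<close> factors, \<open>x = q\<close> and \<open>y = q\<^sup>2\<^sup>N\<close>: in the product of \<open>q\<^sup>2\<^sup>N + q\<^sup>2\<^sup>i\<^sup>+\<^sup>1\<close> the factors with
  \<open>i < N\<close> and those with \<open>i \<ge> N\<close> are, up to powers of \<open>q\<close>, two copies of the product on the left.
  The powers of \<open>q\<close> split off amount to \<open>q^(3 * N\<^sup>2)\<close> on either side and cancel. The exponent
  \<open>N - min j (2 * N - j)\<close> is the absolute difference of \<open>j\<close> and \<open>N\<close>.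
\<close>

lemma prod_odd_squared_eq_sum_qbinom:
  "(\<Prod>i<N. 1 + (fps_X :: real fps) ^ (2 * i + 1))\<^sup>2 =
     (\<Sum>j\<le>2 * N. fps_X ^ (N - min j (2 * N - j))\<^sup>2 * qbinom (fps_X\<^sup>2) (2 * N) j)"
    (is "?P\<^sup>2 = (\<Sum>j\<le>_. ?s j)")
proof -
  let ?X = "fps_X :: real fps"
  have choose: "2 * (j choose 2) + j = j\<^sup>2" for j :: nat
    by (induction j) (simp_all add: numeral_2_eq_2)
  have exponent: "j\<^sup>2 + 2 * N * (2 * N - j) = 3 * N\<^sup>2 + (N - min j (2 * N - j))\<^sup>2"
    if "j \<le> 2 * N" for j
  proof (cases "j \<le> N")
    case True
    then obtain d where d: "N = j + d" using le_Suc_ex by blast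
    have "min j (2 * N - j) = j" "2 * N - j = j + 2 * d" using d by auto
    then show ?thesis using d by (simp add: power2_eq_square algebra_simps)
  next
    case False
    then obtain d where d: "j = N + d" using le_Suc_ex nat_le_linear by blast
    then have "d \<le> N" using that by simp
    then obtain e where e: "N = d + e" using le_Suc_ex by blast
    have "min j (2 * N - j) = e" "2 * N - j = e" using d e by auto
    then show ?thesis using d e by (simp add: power2_eq_square algebra_simps)
  qed
  have low: "(\<Prod>i<N. ?X ^ (2 * N) + ?X * ?X\<^sup>2 ^ i) = ?X ^ N\<^sup>2 * ?P"
  proof -
    have "?X ^ (2 * N) + ?X * ?X\<^sup>2 ^ i = ?X ^ (2 * i + 1) * (1 + ?X ^ (2 * (N - Suc i) + 1))"
      if "i < N" for i
    proof -
      have "2 * N = (2 * i + 1) + (2 * (N - Suc i) + 1)" using that by simp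
      then have "?X ^ (2 * N) = ?X ^ (2 * i + 1) * ?X ^ (2 * (N - Suc i) + 1)"
        by (metis power_add)
      then show ?thesis by (simp add: distrib_left power_mult[symmetric])
    qed
    then have "(\<Prod>i<N. ?X ^ (2 * N) + ?X * ?X\<^sup>2 ^ i) =
        (\<Prod>i<N. ?X ^ (2 * i + 1)) * (\<Prod>i<N. 1 + ?X ^ (2 * (N - Suc i) + 1))"
      by (simp add: prod.distrib)
    also have "(\<Prod>i<N. ?X ^ (2 * i + 1)) = ?X ^ N\<^sup>2"
    proof -
      have "(\<Sum>i<N. 2 * i + 1) = N\<^sup>2" by (induction N) (simp_all add: power2_eq_square)
      then show ?thesis by (metis power_sum)
    qed
    also have "(\<Prod>i<N. 1 + ?X ^ (2 * (N - Suc i) + 1)) = ?P"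
      by (rule prod.nat_diff_reindex)
    finally show ?thesis .
  qed
  have high: "(\<Prod>i<N. ?X ^ (2 * N) + ?X * ?X\<^sup>2 ^ (N + i)) = ?X ^ (2 * N\<^sup>2) * ?P"
  proof -
    have "(\<Prod>i<N. ?X ^ (2 * N) + ?X * ?X\<^sup>2 ^ (N + i)) =
        (\<Prod>i<N. ?X ^ (2 * N) * (1 + ?X ^ (2 * i + 1)))"
      by (intro prod.cong refl) (simp add: distrib_left power_mult[symmetric] power_add mult_ac)
    then show ?thesis
      by (simp add: prod.distrib power_mult[symmetric] power2_eq_square mult.assoc)
  qed
  have "?X ^ (3 * N\<^sup>2) = ?X ^ N\<^sup>2 * ?X ^ (2 * N\<^sup>2)" by (simp flip: power_add)
  then have "?X ^ (3 * N\<^sup>2) * ?P\<^sup>2 = (?X ^ N\<^sup>2 * ?P) * (?X ^ (2 * N\<^sup>2) * ?P)"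
    by (simp only: power2_eq_square[of ?P]) (simp only: mult_ac)
  also have "\<dots> = (\<Prod>i<N + N. ?X ^ (2 * N) + ?X * ?X\<^sup>2 ^ i)"
    unfolding low[symmetric] high[symmetric]
  proof -
    have "prod g {..<N + N} = prod g {..<N} * (\<Prod>i<N. g (N + i))" for g :: "nat \<Rightarrow> real fps"
      using prod.atLeastLessThan_concat[of 0 N "N + N" g] prod.shift_bounds_nat_ivl[of g 0 N N]
      by (simp add: lessThan_atLeast0 add.commute)
    then show "(\<Prod>i<N. ?X ^ (2 * N) + ?X * ?X\<^sup>2 ^ i) *
        (\<Prod>i<N. ?X ^ (2 * N) + ?X * ?X\<^sup>2 ^ (N + i)) =
        (\<Prod>i<N + N. ?X ^ (2 * N) + ?X * ?X\<^sup>2 ^ i)" by simp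
  qed
  also have "\<dots> = (\<Sum>j\<le>2 * N. ?X ^ (3 * N\<^sup>2) * ?s j)"
    unfolding q_binomial_theorem mult_2[symmetric]
  proof (intro sum.cong refl)
    fix j assume "j \<in> {..2 * N}"
    then have j: "j \<le> 2 * N" by simp
    have "?X\<^sup>2 ^ (j choose 2) * ?X ^ j * (?X ^ (2 * N)) ^ (2 * N - j) =
        ?X ^ (3 * N\<^sup>2) * ?X ^ (N - min j (2 * N - j))\<^sup>2"
      by (simp only: power_mult[symmetric] power_add[symmetric] choose exponent[OF j])
    then show "?X\<^sup>2 ^ (j choose 2) * qbinom (?X\<^sup>2) (2 * N) j * ?X ^ j * (?X ^ (2 * N)) ^ (2 * N - j) =
        ?X ^ (3 * N\<^sup>2) * ?s j"
      by (simp add: mult_ac)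
  qed
  finally show ?thesis by (simp flip: sum_distrib_left)
qed

text \<open>
  Multiplied by \<open>(q\<^sup>2; q\<^sup>2)\<^sub>N\<close>, each Gaussian binomial in the finite theta identity
  becomes \<open>1\<close> modulo \<open>q^(2 * (r + 1))\<close> with \<open>r = N - k\<close>, where \<open>k\<close> is the distance of \<open>j\<close>
  from \<open>N\<close>. The loss of precision for large \<open>k\<close> is made up by the factor \<open>q^(k\<^sup>2)\<close>, because
  \<open>k\<^sup>2 + 2 * (N - k + 1) \<ge> 2 * N + 1\<close>, that is, \<open>(k - 1)\<^sup>2 \<ge> 0\<close>.
\<close>

lemma theta_product_mod:
  "((\<Prod>i<N. 1 - (fps_X :: real fps) ^ (2 * i + 2)) * (\<Prod>i<N. 1 + fps_X ^ (2 * i + 1))\<^sup>2)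
     mod fps_X ^ Suc (2 * N) =
   (\<Sum>j\<le>2 * N. fps_X ^ (N - min j (2 * N - j))\<^sup>2) mod fps_X ^ Suc (2 * N)"
proof -
  let ?X = "fps_X :: real fps" and ?k = "\<lambda>j. N - min j (2 * N - j)"
  have *: "?X ^ Suc (2 * N) dvd
      ?X ^ (?k j)\<^sup>2 * (qbinom (?X\<^sup>2) (2 * N) j * qpoch (?X\<^sup>2) N) - ?X ^ (?k j)\<^sup>2"
    if "j \<le> 2 * N" for j
  proof -
    let ?r = "min j (2 * N - j)"
    have r: "?r \<le> N" by auto
    have "?X\<^sup>2 ^ Suc ?r dvd qbinom (?X\<^sup>2) (2 * N) j * qpoch (?X\<^sup>2) N - 1"
      using qbinom_mult_qpoch_mod[of "?X\<^sup>2" j "2 * N - j" N] that r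
      by (simp add: mod_eq_dvd_iff)
    then have "?X ^ (?k j)\<^sup>2 * ?X\<^sup>2 ^ Suc ?r dvd
        ?X ^ (?k j)\<^sup>2 * (qbinom (?X\<^sup>2) (2 * N) j * qpoch (?X\<^sup>2) N - 1)"
      by (rule mult_dvd_mono[OF dvd_refl])
    moreover have "Suc (2 * N) \<le> (?k j)\<^sup>2 + 2 * Suc ?r"
    proof -
      have "Suc (2 * (k + r)) \<le> k\<^sup>2 + 2 * Suc r" for k r :: nat
        by (cases k) (simp_all add: power2_eq_square)
      from this[of "?k j" ?r] show ?thesis using r by (simp only: le_add_diff_inverse2)
    qed
    then have "?X ^ Suc (2 * N) dvd ?X ^ (?k j)\<^sup>2 * ?X\<^sup>2 ^ Suc ?r"
      unfolding power_mult[symmetric] power_add[symmetric] by (rule le_imp_power_dvd)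
    ultimately show ?thesis by (auto simp: right_diff_distrib intro: dvd_trans)
  qed
  have "(\<Prod>i<N. 1 - ?X ^ (2 * i + 2)) = qpoch (?X\<^sup>2) N"
    unfolding qpoch_def by (intro prod.cong refl) (simp only: power_mult[symmetric] mult_Suc_right add.commute)
  then have "(\<Prod>i<N. 1 - ?X ^ (2 * i + 2)) * (\<Prod>i<N. 1 + ?X ^ (2 * i + 1))\<^sup>2 =
      (\<Sum>j\<le>2 * N. ?X ^ (?k j)\<^sup>2 * (qbinom (?X\<^sup>2) (2 * N) j * qpoch (?X\<^sup>2) N))"
    unfolding prod_odd_squared_eq_sum_qbinom by (simp add: sum_distrib_left mult_ac)
  then show ?thesis
    unfolding mod_eq_dvd_iff using * by (auto simp: sum_subtractf[symmetric] intro!: dvd_sum)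
qed

text \<open>
  With \<open>N = n\<close>, the indices \<open>j\<close> contributing \<open>q^(k\<^sup>2)\<close> with \<open>k\<^sup>2 = n\<close> are \<open>n - k\<close> and \<open>n + k\<close>. Both
  lie in the range of summation since \<open>k \<le> k\<^sup>2\<close>, and they differ because \<open>n\<close> is positive.
\<close>

lemma theta_product_nth:
  assumes "n \<ge> 1"
  shows "((\<Prod>i<n. 1 - (fps_X :: real fps) ^ (2 * i + 2)) * (\<Prod>i<n. 1 + fps_X ^ (2 * i + 1))\<^sup>2) $ n =
    (if \<exists>k. n = k\<^sup>2 then 2 else 0)"
proof -
  let ?k = "\<lambda>j. n - min j (2 * n - j)"
  have "((\<Prod>i<n. 1 - (fps_X :: real fps) ^ (2 * i + 2)) * (\<Prod>i<n. 1 + fps_X ^ (2 * i + 1))\<^sup>2) $ n =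
      (\<Sum>j\<le>2 * n. (fps_X :: real fps) ^ (?k j)\<^sup>2) $ n"
    by (rule mod_fps_X_power_nth[OF theta_product_mod]) simp
  also have "\<dots> = real (card {j \<in> {..2 * n}. n = (?k j)\<^sup>2})"
    by (simp add: fps_sum_nth sum.If_cases Int_def del: min.absorb1)
  also have "card {j \<in> {..2 * n}. n = (?k j)\<^sup>2} = (if \<exists>k. n = k\<^sup>2 then 2 else 0)"
  proof (cases "\<exists>k. n = k\<^sup>2")
    case True
    then obtain k where k: "n = k\<^sup>2" by blast
    then have "0 < k" "k \<le> n" using assms by (auto simp: power2_eq_square intro!: gr0I)
    have square: "n = (?k j)\<^sup>2 \<longleftrightarrow> ?k j = k" for j
    proof -
      have "k\<^sup>2 = (?k j)\<^sup>2 \<longleftrightarrow> k = ?k j" by (rule power2_eq_iff_nonneg) auto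
      then show ?thesis using k by auto
    qed
    have "j \<le> 2 * n \<and> ?k j = k \<longleftrightarrow> j = n - k \<or> j = n + k" for j
      using \<open>0 < k\<close> \<open>k \<le> n\<close> by (auto simp: min_def)
    then have "{j \<in> {..2 * n}. n = (?k j)\<^sup>2} = {n - k, n + k}"
      by (intro set_eqI) (simp only: mem_Collect_eq atMost_iff insert_iff empty_iff square simp_thms)
    then show ?thesis using \<open>0 < k\<close> True by simp
  next
    case False
    then show ?thesis by auto
  qed
  finally show ?thesis by simp
qed

text \<open>
  Euler's identity between partitions into odd and into distinct parts. Multiplying by
  \<open>(q\<^sup>2; q\<^sup>2)\<^sub>N\<close> completes the first product to \<open>(q; q)\<^sub>2\<^sub>N\<close>; together with the factors \<open>1 + q\<^sup>i\<close> this
  telescopes exactly to \<open>(q\<^sup>2; q\<^sup>2)\<^sub>2\<^sub>N\<close>, which agrees with \<open>(q\<^sup>2; q\<^sup>2)\<^sub>N\<close> modulo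
  \<open>q^(2 * N + 2)\<close>.
\<close>

lemma euler_product_mod:
  "((\<Prod>i<N. 1 - (fps_X :: real fps) ^ (2 * i + 1)) *
     ((\<Prod>i<N. 1 + fps_X ^ (2 * i + 2)) * (\<Prod>i<N. 1 + fps_X ^ (2 * i + 1))))
     mod fps_X ^ Suc (2 * N) = 1 mod fps_X ^ Suc (2 * N)"
proof (rule cancel_unit_mod)
  let ?X = "fps_X :: real fps"
  let ?D = "\<Prod>i<N. 1 - ?X ^ (2 * i + 1)"
  let ?E = "(\<Prod>i<N. 1 + ?X ^ (2 * i + 2)) * (\<Prod>i<N. 1 + ?X ^ (2 * i + 1))"
  show "qpoch (?X\<^sup>2) N $ 0 \<noteq> 0" by (simp add: qpoch_nth_0)
  have exact: "qpoch (?X\<^sup>2) N * (?D * ?E) = qpoch (?X\<^sup>2) (2 * N)"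
  proof (induction N)
    case (Suc N)
    let ?a = "?X ^ (2 * N + 1)" and ?b = "?X ^ (2 * N + 2)"
    have square: "?X\<^sup>2 ^ m = (?X ^ m)\<^sup>2" for m
      by (simp only: power_mult[symmetric] mult.commute)
    have factor: "1 - z\<^sup>2 = (1 - z) * (1 + z)" for z :: "real fps"
      by (simp add: power2_eq_square algebra_simps)
    have "?X\<^sup>2 ^ Suc N = ?b"
      by (simp only: power_mult[symmetric] mult_Suc_right add.commute)
    then have step: "qpoch (?X\<^sup>2) (Suc N) = qpoch (?X\<^sup>2) N * (1 - ?b)"
      by (simp only: qpoch_Suc)
    have "qpoch (?X\<^sup>2) (2 * Suc N) =
        qpoch (?X\<^sup>2) (2 * N) * (1 - ?X\<^sup>2 ^ (2 * N + 1)) * (1 - ?X\<^sup>2 ^ (2 * N + 2))"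
      by (simp add: qpoch_Suc)
    also have "\<dots> = qpoch (?X\<^sup>2) (2 * N) * ((1 - ?a) * (1 + ?a)) * ((1 - ?b) * (1 + ?b))"
      by (simp only: square factor)
    finally show ?case
      unfolding Suc.IH[symmetric] step prod.lessThan_Suc by (simp only: mult_ac)
  qed simp
  have "qpoch (?X\<^sup>2) (2 * N) mod ?X\<^sup>2 ^ Suc N = qpoch (?X\<^sup>2) N mod ?X\<^sup>2 ^ Suc N"
    by (rule qpoch_mod) simp
  moreover have "?X ^ Suc (2 * N) dvd ?X\<^sup>2 ^ Suc N"
    unfolding power_mult[symmetric] by (rule le_imp_power_dvd) simp
  ultimately have "qpoch (?X\<^sup>2) (2 * N) mod ?X ^ Suc (2 * N) = qpoch (?X\<^sup>2) N mod ?X ^ Suc (2 * N)"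
    by (auto simp: mod_eq_dvd_iff intro: dvd_trans)
  then show "(qpoch (?X\<^sup>2) N * (?D * ?E)) mod ?X ^ Suc (2 * N) =
      (qpoch (?X\<^sup>2) N * 1) mod ?X ^ Suc (2 * N)"
    unfolding exact mult_1_right .
qed

section \<open>Two-color partitions without repeated parts\<close>

text \<open>
  Expanding the product chooses a set \<open>T\<close> of factors that contribute their second term, and the
  exponents of \<open>q\<close> add up. Thus sets of parts of given total weight are counted with signs \<open>s\<close>.
\<close>

lemma fps_nth_prod_one_plus:
  fixes s :: "'a \<Rightarrow> 'b::comm_ring_1"
  assumes "finite A"
  shows "(\<Prod>p\<in>A. 1 + fps_const (s p) * fps_X ^ w p) $ n =
    (\<Sum>T | T \<subseteq> A \<and> sum w T = n. \<Prod>p\<in>T. s p)"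
proof -
  have const: "(\<Prod>p\<in>T. fps_const (s p)) = fps_const (\<Prod>p\<in>T. s p)" for T
    by (induction T rule: infinite_finite_induct) (simp_all add: fps_const_mult)
  have "(\<Prod>p\<in>A. 1 + fps_const (s p) * fps_X ^ w p) =
      (\<Sum>T\<in>Pow A. fps_const (\<Prod>p\<in>T. s p) * fps_X ^ sum w T)"
    using prod_add[OF assms, of "\<lambda>p. fps_const (s p) * fps_X ^ w p" "\<lambda>_. 1"]
    by (simp add: add.commute prod.distrib const power_sum)
  then have "(\<Prod>p\<in>A. 1 + fps_const (s p) * fps_X ^ w p) $ n =
      (\<Sum>T\<in>Pow A. if sum w T = n then \<Prod>p\<in>T. s p else 0)"
    by (auto simp: fps_sum_nth fps_mult_fps_X_power_nonzero intro!: sum.cong)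
  also have "\<dots> = (\<Sum>T | T \<subseteq> A \<and> sum w T = n. \<Prod>p\<in>T. s p)"
    using assms by (simp add: sum.inter_filter[symmetric])
  finally show ?thesis .
qed

text \<open>
  The admissible parts of size at most \<open>2 * N\<close>, listed so that products over them split
  immediately into products over \<open>i < N\<close>; \<open>mem_H_parts\<close> gives the expected description.
\<close>

definition H_parts :: "nat \<Rightarrow> (nat \<times> color) set" where
  "H_parts N = (\<lambda>i. (2 * i + 2, Blue)) ` {..<N} \<union>
     ((\<lambda>i. (2 * i + 1, Blue)) ` {..<N} \<union> (\<lambda>i. (2 * i + 1, Red)) ` {..<N})"

lemma finite_H_parts: "finite (H_parts N)"
  by (simp add: H_parts_def)

lemma prod_H_parts:
  "(\<Prod>p\<in>H_parts N. g p) =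
    (\<Prod>i<N. g (2 * i + 2, Blue)) * ((\<Prod>i<N. g (2 * i + 1, Blue)) * (\<Prod>i<N. g (2 * i + 1, Red)))"
proof -
  let ?E = "(\<lambda>i. (2 * i + 2, Blue)) ` {..<N}"
  let ?B = "(\<lambda>i. (2 * i + 1, Blue)) ` {..<N}" and ?R = "(\<lambda>i. (2 * i + 1, Red)) ` {..<N}"
  have "even (fst p)" if "p \<in> ?E" for p using that by auto
  moreover have "odd (fst p)" if "p \<in> ?B \<union> ?R" for p using that by auto
  ultimately have "?E \<inter> (?B \<union> ?R) = {}" by blast
  moreover have "?B \<inter> ?R = {}" by auto
  ultimately show ?thesis
    unfolding H_parts_def by (simp add: prod.union_disjoint prod.reindex inj_on_def)
qed

lemma mem_H_parts:
  assumes "m \<le> 2 * N"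
  shows "(m, c) \<in> H_parts N \<longleftrightarrow> 0 < m \<and> (even m \<longrightarrow> c = Blue)"
proof
  assume "0 < m \<and> (even m \<longrightarrow> c = Blue)"
  then have *: "0 < m" "even m \<Longrightarrow> c = Blue" by auto
  show "(m, c) \<in> H_parts N"
  proof (cases "even m")
    case True
    then obtain j where "m = 2 * j" by (elim evenE)
    then have "m = 2 * (j - 1) + 2" "j - 1 < N" using *(1) assms by auto
    then show ?thesis using True *(2) by (auto simp: H_parts_def)
  next
    case False
    then obtain j where "m = 2 * j + 1" by (elim oddE)
    then show ?thesis using assms by (cases c) (auto simp: H_parts_def)
  qed
qed (auto simp: H_parts_def)

lemma mset_set_set_mset_H_set:
  assumes "P \<in> H_set n"
  shows "mset_set (set_mset P) = P"
proof (rule multiset_eqI)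
  fix p
  have le: "count P p \<le> 1" using assms unfolding H_set_def by blast
  show "count (mset_set (set_mset P)) p = count P p"
  proof (cases "p \<in># P")
    case True
    then have "0 < count P p" by simp
    then have "count P p = 1" using le by linarith
    then show ?thesis using True by (simp add: count_mset_set')
  qed (simp add: count_mset_set' not_in_iff[symmetric])
qed

text \<open>
  A multiset without repetitions is a set. The parts of a partition of \<open>n\<close> have size at most \<open>n\<close>,
  so any bound \<open>2 * N \<ge> n\<close> on the sizes loses nothing.
\<close>

lemma bij_betw_H_set:
  assumes "n \<le> 2 * N"
  shows "bij_betw set_mset (H_set n) {T. T \<subseteq> H_parts N \<and> sum fst T = n}"
proof (rule bij_betwI[where g = mset_set])
  show "mset_set (set_mset P) = P" if "P \<in> H_set n" for P
    using that by (rule mset_set_set_mset_H_set)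
  show "set_mset \<in> H_set n \<rightarrow> {T. T \<subseteq> H_parts N \<and> sum fst T = n}"
  proof (intro Pi_I CollectI conjI subsetI)
    fix P assume P: "P \<in> H_set n"
    have "sum fst (set_mset P) = (\<Sum>p\<in>#mset_set (set_mset P). fst p)"
      by (simp add: sum_unfold_sum_mset)
    then show sum: "sum fst (set_mset P) = n"
      using P by (simp add: mset_set_set_mset_H_set[OF P] H_set_def F_set_def two_color_partitions_def)
    fix p assume p: "p \<in># P"
    then have "fst p \<le> n" unfolding sum[symmetric] by (intro member_le_sum) auto
    then have "fst p \<le> 2 * N" using assms by simp
    then show "p \<in> H_parts N"
      using P p mem_H_parts[of "fst p" N "snd p"]
      by (auto simp: H_set_def F_set_def two_color_partitions_def)
  qed
  show "mset_set \<in> {T. T \<subseteq> H_parts N \<and> sum fst T = n} \<rightarrow> H_set n"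
  proof (intro Pi_I)
    fix T assume "T \<in> {T. T \<subseteq> H_parts N \<and> sum fst T = n}"
    then have T: "T \<subseteq> H_parts N" and sum: "sum fst T = n" by auto
    have [simp]: "finite T" using T finite_H_parts finite_subset by blast
    have "fst p \<le> 2 * N" if "p \<in> T" for p
    proof -
      have "fst p \<le> sum fst T" using that by (intro member_le_sum) auto
      then show ?thesis using sum assms by simp
    qed
    then have "0 < fst p \<and> (even (fst p) \<longrightarrow> snd p = Blue)" if "p \<in> T" for p
      using that T mem_H_parts[of "fst p" N "snd p"] by auto
    then show "mset_set T \<in> H_set n"
      using sum
      by (auto simp: H_set_def F_set_def two_color_partitions_def sum_unfold_sum_mset count_mset_set')
  qed
  show "set_mset (mset_set T) = T" if "T \<in> {T. T \<subseteq> H_parts N \<and> sum fst T = n}" for T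
    using that finite_H_parts finite_subset[of T] by (auto intro!: finite_set_mset_mset_set)
qed

lemma sum_H_set_eq_nth:
  fixes s :: "nat \<times> color \<Rightarrow> 'b::comm_ring_1"
  assumes "n \<le> 2 * N"
  shows "(\<Sum>P\<in>H_set n. \<Prod>p\<in>set_mset P. s p) =
    (\<Prod>p\<in>H_parts N. 1 + fps_const (s p) * fps_X ^ fst p) $ n"
  unfolding fps_nth_prod_one_plus[OF finite_H_parts]
  by (rule sum.reindex_bij_betw[OF bij_betw_H_set[OF assms]])

lemma card_H_set:
  assumes "n \<le> 2 * N"
  shows "real (card (H_set n)) =
    ((\<Prod>i<N. 1 + fps_X ^ (2 * i + 2)) * (\<Prod>i<N. 1 + fps_X ^ (2 * i + 1))\<^sup>2) $ n"
  using sum_H_set_eq_nth[OF assms, of "\<lambda>_. 1 :: real"]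
  by (simp add: prod_H_parts power2_eq_square)

lemma H0_add_H1: "H0 n + H1 n = card (H_set n)"
  unfolding H0_def H1_def
  by (subst card_Un_disjoint[symmetric]) (auto simp: finite_H_set intro!: arg_cong[where f=card])

lemma H0_diff_H1:
  assumes "n \<le> 2 * N"
  shows "real (H0 n) - real (H1 n) =
    ((\<Prod>i<N. 1 - fps_X ^ (2 * i + 2)) * (\<Prod>i<N. 1 + fps_X ^ (2 * i + 1))\<^sup>2) $ n"
proof -
  let ?s = "\<lambda>p :: nat \<times> color. if even (fst p) then - 1 else 1 :: real"
  have prod: "(\<Prod>p\<in>set_mset P. ?s p) = (if even (even_parts P) then 1 else - 1)"
    if "P \<in> H_set n" for P
  proof -
    have "even_parts P = card {p \<in> set_mset P. even (fst p)}"
      unfolding even_parts_def by (subst (1) mset_set_set_mset_H_set[OF that, symmetric]) simp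
    moreover have "(\<Prod>p\<in>set_mset P. ?s p) = (-1) ^ card {p \<in> set_mset P. even (fst p)}"
      by (subst prod.inter_filter[symmetric]) simp_all
    ultimately show ?thesis by simp
  qed
  have "real (H0 n) - real (H1 n) = (\<Sum>P\<in>H_set n. if even (even_parts P) then 1 else - 1)"
    unfolding H0_def H1_def by (simp add: sum.If_cases finite_H_set Int_def conj_commute)
  also have "\<dots> = (\<Sum>P\<in>H_set n. \<Prod>p\<in>set_mset P. ?s p)"
    by (intro sum.cong refl prod[symmetric])
  also have "\<dots> = ((\<Prod>i<N. 1 - fps_X ^ (2 * i + 2)) * (\<Prod>i<N. 1 + fps_X ^ (2 * i + 1))\<^sup>2) $ n"
    unfolding sum_H_set_eq_nth[OF assms]
    by (simp add: prod_H_parts power2_eq_square fps_const_neg[symmetric] del: fps_const_neg)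
  finally show ?thesis .
qed

text \<open>
  The number of odd parts has the parity of the sum of all parts.
\<close>

lemma even_size_iff:
  "even (size P) \<longleftrightarrow> (even (even_parts P) \<longleftrightarrow> even (\<Sum>p\<in>#P. fst p))"
  by (induction P) (auto simp: even_parts_def)

lemma H2_H3_eq:
  "H2 n = (if even n then H0 n else H1 n)" "H3 n = (if even n then H1 n else H0 n)"
proof -
  have "even (size P) \<longleftrightarrow> (even (even_parts P) \<longleftrightarrow> even n)" if "P \<in> H_set n" for P
    using that even_size_iff[of P] by (auto simp: H_set_def F_set_def two_color_partitions_def)
  then show "H2 n = (if even n then H0 n else H1 n)" "H3 n = (if even n then H1 n else H0 n)"
    unfolding H0_def H1_def H2_def H3_def by (auto intro!: arg_cong[where f=card])
qed

section \<open>Overpartitions\<close>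

text \<open>
  Overpartitions with part sizes in \<open>A\<close>. Allowing an arbitrary \<open>A\<close> lets the generating function be
  computed by adding one part size at a time.
\<close>

definition overpartitions_in :: "nat set \<Rightarrow> nat \<Rightarrow> (nat multiset \<times> nat set) set" where
  "overpartitions_in A n = {(M, S). set_mset M \<subseteq> A \<and> \<Sum>\<^sub># M = n \<and> S \<subseteq> set_mset M}"

definition overpartition_gf :: "nat set \<Rightarrow> real fps" where
  "overpartition_gf A = Abs_fps (\<lambda>n. real (card (overpartitions_in A n)))"

lemma finite_overpartitions_in:
  assumes "finite A" "0 \<notin> A"
  shows "finite (overpartitions_in A n)"
proof (rule finite_subset)
  show "overpartitions_in A n \<subseteq> {M. set_mset M \<subseteq> A \<and> size M \<le> n} \<times> Pow A"
  proof (clarsimp simp: overpartitions_in_def, intro conjI)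
    fix M S assume M: "set_mset M \<subseteq> A" and S: "S \<subseteq> set_mset M"
    show "size M \<le> \<Sum>\<^sub># M" using size_le_sum_mset[of M "\<lambda>m. m"] M assms(2)
      by (metis gr0I image_mset.identity subsetD id_apply multiset.map_id0 multiset.map_ident)
    show "S \<subseteq> A" using M S by blast
  qed
  show "finite ({M. set_mset M \<subseteq> A \<and> size M \<le> n} \<times> Pow A)"
    using assms(1) finite_bounded_multisets by blast
qed

text \<open>
  The coefficient form of \<open>G' (1 - q\<^sup>a) = G (1 + q\<^sup>a)\<close>, where \<open>G\<close> and \<open>G'\<close> are the generating
  functions for \<open>A\<close> and \<open>insert a A\<close>. An overpartition that contains \<open>a\<close> is obtained from the one
  with an occurrence of \<open>a\<close> removed. Either that one is still an overpartition with the same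
  overlined sizes, or \<open>a\<close> was overlined and has disappeared, in which case what remains is an
  overpartition with sizes in \<open>A\<close> once the overline is dropped.
\<close>

lemma card_overpartitions_in_insert:
  assumes "finite A" "0 \<notin> A" "a \<notin> A" "0 < a"
  shows "card (overpartitions_in (insert a A) n) = card (overpartitions_in A n) +
    (if n < a then 0 else
       card (overpartitions_in (insert a A) (n - a)) + card (overpartitions_in A (n - a)))"
proof -
  let ?O = "overpartitions_in A" and ?O' = "overpartitions_in (insert a A)"
  let ?U = "{x \<in> ?O' n. a \<in># fst x}"
  have fin: "finite (?O m)" "finite (?O' m)" for m
    using assms by (auto intro!: finite_overpartitions_in)
  have "?O' n = ?O n \<union> ?U"
    by (auto simp: overpartitions_in_def)
  moreover have "?O n \<inter> ?U = {}"
    using assms(3) by (auto simp: overpartitions_in_def)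
  ultimately have "card (?O' n) = card (?O n) + card ?U"
    using fin by (metis (no_types, lifting) card_Un_disjoint finite_Un)
  also have "card ?U = (if n < a then 0 else card (?O' (n - a)) + card (?O (n - a)))"
  proof (cases "n < a")
    case True
    have "?U = {}"
    proof (rule ccontr)
      assume "?U \<noteq> {}"
      then obtain M S where "a \<in># M" "\<Sum>\<^sub># M = n" by (auto simp: overpartitions_in_def)
      then show False using True by (auto dest!: multi_member_split)
    qed
    then show ?thesis using True by (simp only: card.empty if_True)
  next
    case False
    let ?f = "\<lambda>(M, S). (add_mset a M, S)" and ?g = "\<lambda>(M, S). (add_mset a M, insert a S)"
    have "?U = ?f ` ?O' (n - a) \<union> ?g ` ?O (n - a)"
    proof (intro equalityI subsetI)
      fix x assume "x \<in> ?U"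
      then obtain M S where x: "x = (add_mset a M, S)"
        and M: "set_mset M \<subseteq> insert a A" "a + \<Sum>\<^sub># M = n" "S \<subseteq> insert a (set_mset M)"
        by (cases x) (auto simp: overpartitions_in_def dest!: multi_member_split)
      show "x \<in> ?f ` ?O' (n - a) \<union> ?g ` ?O (n - a)"
      proof (cases "S \<subseteq> set_mset M")
        case True
        then have "(M, S) \<in> ?O' (n - a)" using M by (auto simp: overpartitions_in_def)
        then show ?thesis using x by force
      next
        case False
        then have "a \<in> S" "a \<notin># M" using M(3) by auto
        then have "(M, S - {a}) \<in> ?O (n - a)" "insert a (S - {a}) = S"
          using M by (auto simp: overpartitions_in_def)
        then show ?thesis using x by force
      qed
    qed (use False in \<open>auto simp: overpartitions_in_def\<close>)
    moreover have "?f ` ?O' (n - a) \<inter> ?g ` ?O (n - a) = {}"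
      using assms(3) by (auto simp: overpartitions_in_def)
    moreover have "inj_on ?f (?O' (n - a))" by (auto simp: inj_on_def)
    moreover have "inj_on ?g (?O (n - a))"
    proof (rule inj_onI, clarsimp)
      fix M S S' assume "(M, S) \<in> ?O (n - a)" "(M, S') \<in> ?O (n - a)" "insert a S = insert a S'"
      moreover from this have "a \<notin> S" "a \<notin> S'" using assms(3) by (auto simp: overpartitions_in_def)
      ultimately show "S = S'" by (metis insert_ident)
    qed
    ultimately show ?thesis using False fin by (simp add: card_Un_disjoint card_image)
  qed
  finally show ?thesis .
qed

lemma overpartition_gf_insert:
  assumes "finite A" "0 \<notin> A" "a \<notin> A" "0 < a"
  shows "overpartition_gf (insert a A) * (1 - fps_X ^ a) = overpartition_gf A * (1 + fps_X ^ a)"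
proof (rule fps_ext)
  fix n
  show "(overpartition_gf (insert a A) * (1 - fps_X ^ a)) $ n =
      (overpartition_gf A * (1 + fps_X ^ a)) $ n"
    by (simp add: right_diff_distrib distrib_left fps_X_power_mult_right_nth overpartition_gf_def
        card_overpartitions_in_insert[OF assms])
qed

lemma overpartition_gf_eq:
  assumes "finite A" "0 \<notin> A"
  shows "overpartition_gf A * (\<Prod>a\<in>A. 1 - fps_X ^ a) = (\<Prod>a\<in>A. 1 + fps_X ^ a)"
  using assms
proof (induction A rule: finite_induct)
  case empty
  have "overpartitions_in {} n = (if n = 0 then {({#}, {})} else {})" for n
    by (auto simp: overpartitions_in_def)
  then show ?case by (intro fps_ext) (simp add: overpartition_gf_def)
next
  case (insert a A)
  then have IH: "overpartition_gf A * (\<Prod>a\<in>A. 1 - fps_X ^ a) = (\<Prod>a\<in>A. 1 + fps_X ^ a)"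
    and step: "overpartition_gf (insert a A) * (1 - fps_X ^ a) = overpartition_gf A * (1 + fps_X ^ a)"
    by (auto intro!: overpartition_gf_insert)
  have "overpartition_gf (insert a A) * (\<Prod>a\<in>insert a A. 1 - fps_X ^ a) =
      overpartition_gf (insert a A) * (1 - fps_X ^ a) * (\<Prod>a\<in>A. 1 - fps_X ^ a)"
    using insert.hyps by (simp add: mult.assoc)
  also have "\<dots> = (1 + fps_X ^ a) * (overpartition_gf A * (\<Prod>a\<in>A. 1 - fps_X ^ a))"
    unfolding step by (simp only: mult_ac)
  finally show ?case unfolding IH using insert.hyps by simp
qed

lemma p_o_eq_nth:
  assumes "n \<le> 2 * N"
  shows "real (p_o n) = overpartition_gf ((\<lambda>i. 2 * i + 1) ` {..<N}) $ n"
proof -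
  have "odd_overpartitions n = overpartitions_in ((\<lambda>i. 2 * i + 1) ` {..<N}) n"
  proof -
    have "(\<forall>m\<in>#M. odd m) \<longleftrightarrow> set_mset M \<subseteq> (\<lambda>i. 2 * i + 1) ` {..<N}" if "\<Sum>\<^sub># M = n" for M
    proof
      assume odd: "\<forall>m\<in>#M. odd m"
      show "set_mset M \<subseteq> (\<lambda>i. 2 * i + 1) ` {..<N}"
      proof
        fix m assume m: "m \<in># M"
        then have "m \<le> 2 * N" using that assms by (auto dest!: multi_member_split)
        moreover obtain i where "m = 2 * i + 1" using odd m by (metis oddE)
        ultimately show "m \<in> (\<lambda>i. 2 * i + 1) ` {..<N}" by auto
      qed
    qed auto
    then show ?thesis by (auto simp: odd_overpartitions_def overpartitions_in_def)
  qed
  then show ?thesis by (simp add: p_o_def overpartition_gf_def)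
qed

text \<open>
  Write \<open>G\<close> for the generating function of overpartitions into odd parts, so that \<open>G * D = R\<close>
  with \<open>D = \<Prod>(1 - q\<^sup>2\<^sup>i\<^sup>+\<^sup>1)\<close> and \<open>R = \<Prod>(1 + q\<^sup>2\<^sup>i\<^sup>+\<^sup>1)\<close>. The product counting \<open>H_set n\<close> is \<open>B * R\<^sup>2\<close>
  with \<open>B = \<Prod>(1 + q\<^sup>2\<^sup>i\<^sup>+\<^sup>2)\<close>. Replacing one factor \<open>R\<close> by \<open>G * D\<close> turns it into
  \<open>G * (D * B * R)\<close>, and the bracket is \<open>1\<close> up to the relevant order by Euler's identity.
\<close>

lemma card_H_set_eq_p_o: "card (H_set n) = p_o n"
proof -
  let ?X = "fps_X :: real fps" and ?A = "(\<lambda>i. 2 * i + 1) ` {..<n}"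
  let ?G = "overpartition_gf ?A" and ?R = "\<Prod>i<n. 1 + ?X ^ (2 * i + 1)"
  let ?D = "\<Prod>i<n. 1 - ?X ^ (2 * i + 1)" and ?B = "\<Prod>i<n. 1 + ?X ^ (2 * i + 2)"
  have inj: "inj_on (\<lambda>i. 2 * i + 1 :: nat) {..<n}" by (auto simp: inj_on_def)
  have "?G * ?D = ?R"
    using overpartition_gf_eq[of ?A] unfolding prod.reindex[OF inj] by (simp add: o_def image_iff)
  then have "?B * ?R\<^sup>2 = ?G * (?D * (?B * ?R))" by (simp add: power2_eq_square mult_ac)
  also have "\<dots> mod ?X ^ Suc (2 * n) = (?G * 1) mod ?X ^ Suc (2 * n)"
    by (intro mod_mult_cong refl euler_product_mod)
  finally have "(?B * ?R\<^sup>2) $ n = ?G $ n"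
    by (intro mod_fps_X_power_nth[where m = "Suc (2 * n)"]) simp_all
  then have "real (card (H_set n)) = real (p_o n)"
    using card_H_set[of n n] p_o_eq_nth[of n n] by simp
  then show ?thesis by simp
qed

section \<open>Evaluation of the four counting functions\<close>

theorem theorem6:
  fixes n :: nat
  assumes "n \<ge> 1"
  shows "real (H0 n) = (if \<exists>k::nat. n = k\<^sup>2 then real (p_o n) / 2 + 1 else real (p_o n) / 2) \<and>
    real (H1 n) = (if \<exists>k::nat. n = k\<^sup>2 then real (p_o n) / 2 - 1 else real (p_o n) / 2) \<and>
    real (H2 n) = (if \<exists>k::nat. n = k\<^sup>2 then real (p_o n) / 2 + (-1) ^ n else real (p_o n) / 2) \<and>
    real (H3 n) = (if \<exists>k::nat. n = k\<^sup>2 then real (p_o n) / 2 - (-1) ^ n else real (p_o n) / 2)"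
proof -
  have "real (H0 n) + real (H1 n) = real (p_o n)"
    using H0_add_H1[of n] card_H_set_eq_p_o[of n] by (metis of_nat_add)
  moreover have "real (H0 n) - real (H1 n) = (if \<exists>k::nat. n = k\<^sup>2 then 2 else 0)"
    using H0_diff_H1[of n n] theta_product_nth[OF assms] by simp
  ultimately show ?thesis
    by (auto simp: H2_H3_eq)
qed

end
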